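(* Let $\mathfrak G$ be the first Grigorchuk group. (a) For every infinite set $A$, there exists a cellular automaton $\tau\colon A^{\mathfrak G}\to A^{\mathfrak G}$ whose image is not closed in the prodiscrete topology. (b) For every field $K$ and every infinite-dimensional $K$-vector space $V$, there exists a linear cellular automaton $\tau\colon V^{\mathfrak G}\to V^{\mathfrak G}$ whose image is not closed in the prodiscrete topology.
   Context: We work in ZFC. Let $\Sigma=\{0,1\}$ and let $\Sigma^*$ be the rooted binary tree of all finite words over $\Sigma$, including the empty word (the root). The first Grigorchuk group is the subgroup $\mathfrak G=\langle a,b,c,d\rangle$ of $\operatorname{Aut}(\Sigma^* )$ generated by the four automorphisms fixing the root and defined recursively, for every $w\in\Sigma^*$, by $a(0w)=1w$, $a(1w)=0w$; $b(0w)=0a(w)$, $b(1w)=1c(w)$; $c(0w)=0a(w)$, $c(1w)=1d(w)$; $d(0w)=0w$, $d(1w)=1b(w)$. For a group $G$ and a set $A$, $A^G$ is the set of all maps $G\to A$, with the prodiscrete topology: the product topology obtained by giving each factor $A$ the discrete topology. The group $G$ acts on $A^G$ by $(gx)(h)=x(g^{-1}h)$. A map $\tau\colon A^G\to A^G$ is a cellular automaton if there exist a finite subset $M\subset G$ (a memory set) and a map $\mu\colon A^M\to A$ (local defining map) such that $\tau(x)(g)=\mu((g^{-1}x)|_M)$ for all $x\in A^G$, $g\in G$; note $(g^{-1}x)(m)=x(gm)$. If $A=V$ is a vector space over a field $K$ and $\mu\colon V^M\to V$ can be taken $K$-linear, then $\tau$ is called a linear cellular automaton. *)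

theory Defs
  imports "HOL-Analysis.Analysis" "HOL-Algebra.Elementary_Groups"
begin

section \<open>The first Grigorchuk group\<close>

text \<open>
  Words over the alphabet 0, 1 are lists of booleans, with \<^term>\<open>False\<close> for the letter 0 and
  \<^term>\<open>True\<close> for the letter 1. The head of the list is the first letter of the word.
\<close>

type_synonym word = "bool list"

definition tree_edge :: "word \<Rightarrow> word \<Rightarrow> bool" where
  "tree_edge u v \<longleftrightarrow> (\<exists>s. v = u @ [s] \<or> u = v @ [s])"

definition tree_aut :: "(word \<Rightarrow> word) monoid" where
  "tree_aut =
    \<lparr>carrier = {f. bij f \<and> f [] = [] \<and> (\<forall>u v. tree_edge (f u) (f v) \<longleftrightarrow> tree_edge u v)},
     mult = (\<circ>), one = id\<rparr>"

fun grig_a :: "word \<Rightarrow> word" where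
  "grig_a [] = []"
| "grig_a (False # w) = True # w"
| "grig_a (True # w) = False # w"

fun grig_b :: "word \<Rightarrow> word" and grig_c :: "word \<Rightarrow> word" and grig_d :: "word \<Rightarrow> word" where
  "grig_b [] = []"
| "grig_b (False # w) = False # grig_a w"
| "grig_b (True # w) = True # grig_c w"
| "grig_c [] = []"
| "grig_c (False # w) = False # grig_a w"
| "grig_c (True # w) = True # grig_d w"
| "grig_d [] = []"
| "grig_d (False # w) = False # w"
| "grig_d (True # w) = True # grig_b w"

text \<open>
  \<^const>\<open>subgroup_generated\<close> intersects the generating set with the carrier; by
  \<open>grig_generators_in_tree_aut\<close> below nothing is lost here.
\<close>

definition Grigorchuk :: "(word \<Rightarrow> word) monoid" where
  "Grigorchuk = subgroup_generated tree_aut {grig_a, grig_b, grig_c, grig_d}"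

lemma group_tree_aut: "group tree_aut"
proof (rule groupI)
  fix f assume f: "f \<in> carrier tree_aut"
  then have b: "bij f" by (simp add: tree_aut_def)
  have "inv_into UNIV f \<in> carrier tree_aut"
  proof -
    have "f (inv_into UNIV f u) = u" for u using b by (simp add: bij_is_surj surj_f_inv_f)
    moreover have "inv_into UNIV f [] = []" using f b
      by (simp add: tree_aut_def) (metis bij_is_inj inv_f_f)
    moreover have "tree_edge (f u) (f v) \<longleftrightarrow> tree_edge u v" for u v
      using f by (simp add: tree_aut_def)
    ultimately show ?thesis
      using bij_imp_bij_inv[OF b] by (simp add: tree_aut_def) metis
  qed
  moreover have "inv_into UNIV f \<circ> f = id" using b by (simp add: bij_is_inj)
  ultimately show "\<exists>g\<in>carrier tree_aut. g \<otimes>\<^bsub>tree_aut\<^esub> f = \<one>\<^bsub>tree_aut\<^esub>"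
    by (auto simp: tree_aut_def)
qed (simp_all add: tree_aut_def bij_comp comp_assoc)

lemma group_Grigorchuk: "group Grigorchuk"
  unfolding Grigorchuk_def by (rule group.group_subgroup_generated[OF group_tree_aut])

lemma grig_a_involution: "grig_a (grig_a w) = w"
  by (induction w rule: grig_a.induct) auto

lemma grig_bcd_involution:
  "grig_b (grig_b w) = w" "grig_c (grig_c w) = w" "grig_d (grig_d w) = w"
  by (induction w and w and w rule: grig_b_grig_c_grig_d.induct) (auto simp: grig_a_involution)

lemma grig_a_snoc: "\<exists>t. grig_a (w @ [s]) = grig_a w @ [t]"
  by (cases w rule: grig_a.cases; cases s) auto

lemma grig_bcd_singleton: "grig_b [s] = [s]" "grig_c [s] = [s]" "grig_d [s] = [s]"
  by (cases s; simp)+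

lemma grig_bcd_snoc:
  "\<exists>t. grig_b (w @ [s]) = grig_b w @ [t]"
  "\<exists>t. grig_c (w @ [s]) = grig_c w @ [t]"
  "\<exists>t. grig_d (w @ [s]) = grig_d w @ [t]"
  by (induction w and w and w rule: grig_b_grig_c_grig_d.induct)
     (simp_all add: grig_bcd_singleton grig_a_snoc)

lemma involution_in_tree_aut:
  assumes inv: "\<And>w. f (f w) = w" and root: "f [] = []"
    and snoc: "\<And>w s. \<exists>t. f (w @ [s]) = f w @ [t]"
  shows "f \<in> carrier tree_aut"
proof -
  have bij: "bij f" by (rule involuntory_imp_bij) (rule inv)
  have edge: "tree_edge (f u) (f v)" if "tree_edge u v" for u v
    using that snoc unfolding tree_edge_def by metis
  have "\<forall>u v. tree_edge (f u) (f v) \<longleftrightarrow> tree_edge u v"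
    using edge edge[of "f u" "f v" for u v, unfolded inv] by blast
  then show ?thesis using bij by (simp add: tree_aut_def root)
qed

lemma grig_generators_in_tree_aut: "{grig_a, grig_b, grig_c, grig_d} \<subseteq> carrier tree_aut"
proof -
  have "grig_a \<in> carrier tree_aut"
    by (rule involution_in_tree_aut) (rule grig_a_involution grig_a_snoc grig_a.simps)+
  moreover have "grig_b \<in> carrier tree_aut"
    by (rule involution_in_tree_aut) (rule grig_bcd_involution grig_bcd_snoc grig_b.simps)+
  moreover have "grig_c \<in> carrier tree_aut"
    by (rule involution_in_tree_aut) (rule grig_bcd_involution grig_bcd_snoc grig_c.simps)+
  moreover have "grig_d \<in> carrier tree_aut"
    by (rule involution_in_tree_aut) (rule grig_bcd_involution grig_bcd_snoc grig_d.simps)+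
  ultimately show ?thesis by blast
qed


section \<open>Cellular automata\<close>

text \<open>
  For a set \<open>A\<close>, the set of maps from \<open>M\<close> to \<open>A\<close> is the extensional function space
  \<^term>\<open>M \<rightarrow>\<^sub>E A\<close>, so that maps on \<open>M\<close> have a unique representative.
\<close>

abbreviation configs :: "('g, 'm) monoid_scheme \<Rightarrow> 'a set \<Rightarrow> ('g \<Rightarrow> 'a) set" where
  "configs G A \<equiv> carrier G \<rightarrow>\<^sub>E A"

definition prodiscrete :: "('g, 'm) monoid_scheme \<Rightarrow> 'a set \<Rightarrow> ('g \<Rightarrow> 'a) topology" where
  "prodiscrete G A = product_topology (\<lambda>_. discrete_topology A) (carrier G)"

definition shift :: "('g, 'm) monoid_scheme \<Rightarrow> 'g \<Rightarrow> ('g \<Rightarrow> 'a) \<Rightarrow> 'g \<Rightarrow> 'a" where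
  "shift G g x = (\<lambda>h\<in>carrier G. x (inv\<^bsub>G\<^esub> g \<otimes>\<^bsub>G\<^esub> h))"

definition has_local_map ::
  "('g, 'm) monoid_scheme \<Rightarrow> 'a set \<Rightarrow> (('g \<Rightarrow> 'a) \<Rightarrow> 'g \<Rightarrow> 'a) \<Rightarrow> 'g set \<Rightarrow> (('g \<Rightarrow> 'a) \<Rightarrow> 'a) \<Rightarrow> bool"
where
  "has_local_map G A \<tau> M \<mu> \<longleftrightarrow>
     finite M \<and> M \<subseteq> carrier G \<and> \<mu> \<in> (M \<rightarrow>\<^sub>E A) \<rightarrow> A \<and>
     (\<forall>x\<in>configs G A. \<forall>g\<in>carrier G. \<tau> x g = \<mu> (restrict (shift G (inv\<^bsub>G\<^esub> g) x) M))"

definition cellular_automaton ::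
  "('g, 'm) monoid_scheme \<Rightarrow> 'a set \<Rightarrow> (('g \<Rightarrow> 'a) \<Rightarrow> 'g \<Rightarrow> 'a) \<Rightarrow> bool" where
  "cellular_automaton G A \<tau> \<longleftrightarrow>
     \<tau> \<in> configs G A \<rightarrow> configs G A \<and> (\<exists>M \<mu>. has_local_map G A \<tau> M \<mu>)"

text \<open>
  Linearity of a map from \<^term>\<open>M \<rightarrow>\<^sub>E UNIV\<close>, with the pointwise vector space structure, to the
  vector space with scalar multiplication \<open>smul\<close>. The pointwise operations must be restricted
  to \<open>M\<close> to stay inside the extensional function space.
\<close>

definition linear_local_map ::
  "('k::field \<Rightarrow> 'v::ab_group_add \<Rightarrow> 'v) \<Rightarrow> 'g set \<Rightarrow> (('g \<Rightarrow> 'v) \<Rightarrow> 'v) \<Rightarrow> bool" where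
  "linear_local_map smul M \<mu> \<longleftrightarrow>
     (\<forall>x\<in>M \<rightarrow>\<^sub>E UNIV. \<forall>y\<in>M \<rightarrow>\<^sub>E UNIV. \<mu> (\<lambda>m\<in>M. x m + y m) = \<mu> x + \<mu> y) \<and>
     (\<forall>r. \<forall>x\<in>M \<rightarrow>\<^sub>E UNIV. \<mu> (\<lambda>m\<in>M. smul r (x m)) = smul r (\<mu> x))"

definition linear_cellular_automaton ::
  "('k::field \<Rightarrow> 'v::ab_group_add \<Rightarrow> 'v) \<Rightarrow> ('g, 'm) monoid_scheme
    \<Rightarrow> (('g \<Rightarrow> 'v) \<Rightarrow> 'g \<Rightarrow> 'v) \<Rightarrow> bool" where
  "linear_cellular_automaton smul G \<tau> \<longleftrightarrow>
     \<tau> \<in> configs G UNIV \<rightarrow> configs G UNIV \<and>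
     (\<exists>M \<mu>. has_local_map G UNIV \<tau> M \<mu> \<and> linear_local_map smul M \<mu>)"

definition infinite_dimensional :: "('k::field \<Rightarrow> 'v::ab_group_add \<Rightarrow> 'v) \<Rightarrow> bool" where
  "infinite_dimensional smul \<longleftrightarrow> \<not> (\<exists>B. finite B \<and> module.span smul B = UNIV)"

end

theory Submission
  imports Defs "HOL-Library.Function_Algebras"
begin

text \<open>
  Only the fact that the group \<open>G\<close> is infinite and finitely generated matters. Let \<open>L\<close> be a finite
  symmetric generating set.

  (a) Read elements of \<open>A\<close> as natural numbers and mark a cell \<open>g\<close> as good if some neighbour \<open>g s\<close>,
  \<open>s \<in> L\<close>, carries a smaller number. The cells cannot all be good, since this would give an infinite
  descent; but the cells of a finite set \<open>F\<close> can, by the word distance to a point outside \<open>F\<close>.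

  (b) Let \<open>T\<^sub>s\<close> act on functions on words by prefixing the letter \<open>s\<close>, and consider
  \<open>x(g) \<mapsto> x(g) - (\<Sum>s\<in>L. T\<^sub>s x(g s))\<close>. Unwinding the equation with right-hand side \<open>\<delta>\<close>, which
  is the indicator of the empty word at the identity and zero elsewhere, shows that \<open>x(1)\<close> must be the
  indicator of the word problem of \<open>G\<close>. That function has infinitely many residuals. The truncated
  solution on a finite set \<open>F\<close>, which only counts paths inside \<open>F\<close>, has finitely many. The truncated
  solutions and their images under words in the \<open>T\<^sub>s\<close> span a space of countable dimension, all of whose
  elements have finitely many residuals. It is a quotient of \<open>V\<close> with a linear section, and
  along these the automaton is transported to \<open>V\<close>.
\<close>

section \<open>Cellular automata and the prodiscrete topology\<close>

text \<open>A basic open set of the product constrains only finitely many coordinates, so agreement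
  with members of \<open>C\<close> on every finite set puts \<open>y\<close> in its closure.\<close>

lemma closedin_prodiscrete_mem:
  assumes cl: "closedin (prodiscrete G A) C" and y: "y \<in> configs G A"
    and approx: "\<And>F. finite F \<Longrightarrow> F \<subseteq> carrier G \<Longrightarrow> \<exists>z\<in>C. \<forall>g\<in>F. z g = y g"
  shows "y \<in> C"
proof (rule ccontr)
  assume "y \<notin> C"
  have top: "topspace (prodiscrete G A) = configs G A"
    by (simp add: prodiscrete_def)
  have "C \<subseteq> configs G A"
    using closedin_subset[OF cl] top by simp
  have "openin (prodiscrete G A) (configs G A - C)"
    using cl by (simp add: closedin_def top)
  with y \<open>y \<notin> C\<close> obtain U where fin: "finite {g \<in> carrier G. U g \<noteq> A}"
    and yU: "y \<in> Pi\<^sub>E (carrier G) U" and sub: "Pi\<^sub>E (carrier G) U \<subseteq> configs G A - C"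
    unfolding prodiscrete_def openin_product_topology_alt by simp blast
  obtain z where z: "z \<in> C" "\<And>g. g \<in> carrier G \<Longrightarrow> U g \<noteq> A \<Longrightarrow> z g = y g"
    using approx[OF fin] by auto
  have "z \<in> Pi\<^sub>E (carrier G) U"
  proof (rule PiE_I)
    fix g assume g: "g \<in> carrier G"
    show "z g \<in> U g"
      using z \<open>C \<subseteq> configs G A\<close> yU g by (cases "U g = A") auto
  next
    fix g assume "g \<notin> carrier G"
    then show "z g = undefined"
      using z \<open>C \<subseteq> configs G A\<close> by (auto simp: PiE_def extensional_def)
  qed
  with sub z show False by blast
qed

context group

\<comment> \<open>Automata given by a local rule\<close>
begin

definition local_rule :: "'a set \<Rightarrow> (('a \<Rightarrow> 'c) \<Rightarrow> 'c) \<Rightarrow> ('a \<Rightarrow> 'c) \<Rightarrow> 'a \<Rightarrow> 'c" where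
  "local_rule M \<mu> x = (\<lambda>g\<in>carrier G. \<mu> (\<lambda>m\<in>M. x (g \<otimes> m)))"

lemma local_rule_maps_configs:
  assumes "M \<subseteq> carrier G" "\<mu> \<in> (M \<rightarrow>\<^sub>E A) \<rightarrow> A"
  shows "local_rule M \<mu> \<in> configs G A \<rightarrow> configs G A"
proof
  fix x assume x: "x \<in> configs G A"
  have "(\<lambda>m\<in>M. x (g \<otimes> m)) \<in> M \<rightarrow>\<^sub>E A" if "g \<in> carrier G" for g
    using that assms(1) x by (auto simp: PiE_def Pi_def)
  then show "local_rule M \<mu> x \<in> configs G A"
    using assms(2) by (auto simp: local_rule_def Pi_def)
qed

lemma has_local_map_local_rule:
  assumes "finite M" "M \<subseteq> carrier G" "\<mu> \<in> (M \<rightarrow>\<^sub>E A) \<rightarrow> A"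
  shows "has_local_map G A (local_rule M \<mu>) M \<mu>"
proof -
  have "restrict (shift G (inv g) x) M = (\<lambda>m\<in>M. x (g \<otimes> m))" if "g \<in> carrier G" for g and x :: "'a \<Rightarrow> 'c"
    using that assms(2) by (auto simp: shift_def fun_eq_iff restrict_def)
  then show ?thesis
    using assms by (simp add: has_local_map_def local_rule_def)
qed

lemma cellular_automaton_local_rule:
  assumes "finite M" "M \<subseteq> carrier G" "\<mu> \<in> (M \<rightarrow>\<^sub>E A) \<rightarrow> A"
  shows "cellular_automaton G A (local_rule M \<mu>)"
  unfolding cellular_automaton_def
  using local_rule_maps_configs[OF assms(2,3)] has_local_map_local_rule[OF assms] by blast

end


section \<open>Infinite finitely generated groups\<close>

locale infinite_fg_group = group G for G (structure) +
  fixes S :: "'a set"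
  assumes finite_S: "finite S"
    and S_subset: "S \<subseteq> carrier G"
    and generate_S: "generate G S = carrier G"
    and infinite_carrier: "infinite (carrier G)"
begin

definition letters :: "'a set" where
  "letters = S \<union> m_inv G ` S"

definition word_prod :: "'a list \<Rightarrow> 'a" where
  "word_prod w = foldr (\<otimes>) w \<one>"

lemma word_prod_simps [simp]:
  "word_prod [] = \<one>" "word_prod (s # w) = s \<otimes> word_prod w"
  by (simp_all add: word_prod_def)

lemma finite_letters: "finite letters"
  using finite_S by (simp add: letters_def)

lemma letters_closed [simp]: "s \<in> letters \<Longrightarrow> s \<in> carrier G"
  using S_subset by (auto simp: letters_def)

lemma word_prod_closed [simp]: "w \<in> lists letters \<Longrightarrow> word_prod w \<in> carrier G"
  by (induction w) auto

lemma word_prod_append: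
  "u \<in> lists letters \<Longrightarrow> w \<in> lists letters \<Longrightarrow> word_prod (u @ w) = word_prod u \<otimes> word_prod w"
  by (induction u) (auto simp: m_assoc)

lemma ex_word:
  assumes "g \<in> carrier G"
  shows "\<exists>w\<in>lists letters. word_prod w = g"
proof -
  have "g \<in> generate G S"
    using assms generate_S by simp
  then show ?thesis
  proof induction
    case one
    then show ?case by (intro bexI[of _ "[]"]) auto
  next
    case (incl h)
    then show ?case using S_subset by (intro bexI[of _ "[h]"]) (auto simp: letters_def)
  next
    case (inv h)
    then show ?case using S_subset by (intro bexI[of _ "[inv h]"]) (auto simp: letters_def)
  next
    case (eng h k)
    then obtain u w where "u \<in> lists letters" "w \<in> lists letters" "word_prod u = h" "word_prod w = k"
      by blast
    then show ?case by (intro bexI[of _ "u @ w"]) (auto simp: word_prod_append)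
  qed
qed

lemma countable_carrier: "countable (carrier G)"
proof -
  have "carrier G \<subseteq> word_prod ` lists letters"
    using ex_word by blast
  then show ?thesis
    using countable_lists[OF countable_finite[OF finite_letters]] countable_image countable_subset
    by blast
qed

definition word_length :: "'a \<Rightarrow> nat" where
  "word_length g = (LEAST n. \<exists>w\<in>lists letters. length w = n \<and> word_prod w = g)"

text \<open>Drop the first letter of a shortest word for \<open>h\<close>.\<close>

lemma ex_letter_shortening:
  assumes "h \<in> carrier G" "h \<noteq> \<one>"
  shows "\<exists>s\<in>letters. word_length (inv s \<otimes> h) < word_length h"
proof -
  have "\<exists>n. \<exists>w\<in>lists letters. length w = n \<and> word_prod w = h"
    using ex_word[OF assms(1)] by blast
  from LeastI_ex[OF this] obtain w
    where w: "w \<in> lists letters" "length w = word_length h" "word_prod w = h"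
    unfolding word_length_def by blast
  with assms(2) obtain s v where sv: "w = s # v"
    by (cases w) auto
  with w have "s \<in> carrier G" "word_prod v \<in> carrier G" "h = s \<otimes> word_prod v"
    by auto
  then have "inv s \<otimes> h = word_prod v"
    by (simp add: m_assoc[symmetric])
  then have "word_length (inv s \<otimes> h) \<le> length v"
    unfolding word_length_def using w sv by (intro Least_le) auto
  then show ?thesis
    using w sv by (intro bexI[of _ s]) auto
qed

section \<open>Part (a): an automaton over an infinite alphabet\<close>

lemma ex_not_closed_image:
  fixes A :: "'c set"
  assumes "infinite A"
  shows "\<exists>\<tau>. cellular_automaton G A \<tau> \<and> \<not> closedin (prodiscrete G A) (\<tau> ` configs G A)"
proof -
  obtain e :: "nat \<Rightarrow> 'c" where e: "inj e" "range e \<subseteq> A"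
    using infinite_countable_subset[OF assms] by blast
  \<comment> \<open>Elements of \<open>A\<close> outside the range of \<open>e\<close> get some
    number too; the descent works whatever it is.\<close>
  define r where "r = inv_into UNIV e"
  have r: "r (e n) = n" for n
    using e by (simp add: r_def)
  define \<mu> :: "('a \<Rightarrow> 'c) \<Rightarrow> 'c"
    where "\<mu> z = (if \<exists>s\<in>letters. r (z s) < r (z \<one>) then e 0 else e 1)" for z
  define M where "M = insert \<one> letters"
  define \<tau> where "\<tau> = local_rule M \<mu>"
  have M: "finite M" "M \<subseteq> carrier G" and \<mu>: "\<mu> \<in> (M \<rightarrow>\<^sub>E A) \<rightarrow> A"
    using finite_letters e by (auto simp: M_def \<mu>_def)
  have \<tau>: "\<tau> x g = e 0 \<longleftrightarrow> (\<exists>s\<in>letters. r (x (g \<otimes> s)) < r (x g))" if "g \<in> carrier G" for x g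
    using that injD[OF e(1), of 1 0] by (auto simp: \<tau>_def local_rule_def \<mu>_def M_def)
  define y where "y = (\<lambda>g\<in>carrier G. e 0)"
  have "y \<notin> \<tau> ` configs G A"
  proof
    assume "y \<in> \<tau> ` configs G A"
    then obtain x where "y = \<tau> x" by blast
    then have desc: "\<exists>s\<in>letters. r (x (g \<otimes> s)) < r (x g)" if "g \<in> carrier G" for g
      using \<tau>[OF that] that by (metis y_def restrict_apply')
    have False if "g \<in> carrier G" for g
      using that
    proof (induction "r (x g)" arbitrary: g rule: less_induct)
      case less
      then show ?case using desc[OF less.prems] by (meson letters_closed m_closed)
    qed
    then show False by blast
  qed
  moreover have "y \<in> \<tau> ` configs G A" if cl: "closedin (prodiscrete G A) (\<tau> ` configs G A)"
  proof (rule closedin_prodiscrete_mem[OF cl])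
    show "y \<in> configs G A"
      using e by (auto simp: y_def)
    fix F assume F: "finite F" "F \<subseteq> carrier G"
    then obtain p where p: "p \<in> carrier G" "p \<notin> F"
      using infinite_carrier by (metis finite_subset subsetI)
    \<comment> \<open>Word distance from \<open>g\<close> to \<open>p\<close>: a letter
      \<open>s\<close> that shortens \<open>inv g \<otimes> p\<close> from the left brings
      \<open>g \<otimes> s\<close> closer to \<open>p\<close>.\<close>
    define x where "x = (\<lambda>g\<in>carrier G. e (word_length (inv g \<otimes> p)))"
    have "\<tau> x g = y g" if g: "g \<in> F" for g
    proof -
      have gc: "g \<in> carrier G" using g F by blast
      have "inv g \<otimes> p \<noteq> \<one>"
        using g gc p by (metis inv_equality inv_inv inv_closed)
      then obtain s where s: "s \<in> letters"
        "word_length (inv s \<otimes> (inv g \<otimes> p)) < word_length (inv g \<otimes> p)"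
        using ex_letter_shortening[of "inv g \<otimes> p"] gc p by auto
      then have "r (x (g \<otimes> s)) < r (x g)"
        using gc p by (simp add: x_def r inv_mult_group m_assoc)
      then show ?thesis
        using \<tau>[OF gc] s gc by (auto simp: y_def)
    qed
    moreover have "x \<in> configs G A"
      using e by (auto simp: x_def)
    ultimately show "\<exists>z\<in>\<tau> ` configs G A. \<forall>g\<in>F. z g = y g"
      by blast
  qed
  moreover have "cellular_automaton G A \<tau>"
    unfolding \<tau>_def by (rule cellular_automaton_local_rule[OF M \<mu>])
  ultimately show ?thesis by blast
qed

end


section \<open>Functions on words\<close>

definition fscale :: "'k::field \<Rightarrow> ('i \<Rightarrow> 'k) \<Rightarrow> 'i \<Rightarrow> 'k" where
  "fscale r f = (\<lambda>i. r * f i)"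

lemma vector_space_fscale: "vector_space (fscale :: 'k::field \<Rightarrow> ('i \<Rightarrow> 'k) \<Rightarrow> 'i \<Rightarrow> 'k)"
  by unfold_locales (auto simp: fscale_def fun_eq_iff algebra_simps)

lemma sum_fun_apply: "(\<Sum>a\<in>A. f a) x = (\<Sum>a\<in>A. f a x)"
  for f :: "'a \<Rightarrow> 'b \<Rightarrow> 'c::comm_monoid_add"
  by (induction A rule: infinite_finite_induct) auto

text \<open>On indicators of languages this is left concatenation with the letter
  \<open>s\<close>.\<close>

definition prepend :: "'s \<Rightarrow> ('s list \<Rightarrow> 'k::zero) \<Rightarrow> 's list \<Rightarrow> 'k" where
  "prepend s f w = (case w of [] \<Rightarrow> 0 | t # v \<Rightarrow> if t = s then f v else 0)"

lemma prepend_simps [simp]: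
  "prepend s f [] = 0" "prepend s f (t # v) = (if t = s then f v else 0)"
  by (simp_all add: prepend_def)

lemma linear_prepend:
  "Vector_Spaces.linear fscale fscale (prepend s :: ('s list \<Rightarrow> 'k::field) \<Rightarrow> _)"
  by (auto simp: Vector_Spaces.linear_iff vector_space_fscale fscale_def fun_eq_iff prepend_def
      split: list.split)

text \<open>The summands have disjoint supports: only the one for the first letter of
  \<open>w\<close> survives.\<close>

lemma sum_prepend:
  fixes h :: "'s \<Rightarrow> 's list \<Rightarrow> 'k::field"
  assumes "finite L"
  shows "(\<Sum>s\<in>L. prepend s (h s)) w = (case w of [] \<Rightarrow> 0 | t # v \<Rightarrow> if t \<in> L then h t v else 0)"
  using assms by (cases w) (simp_all add: sum_fun_apply)

text \<open>The left quotients of the Myhill-Nerode theorem, for functions in place of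
  languages.\<close>

definition residuals :: "('s list \<Rightarrow> 'k) \<Rightarrow> ('s list \<Rightarrow> 'k) set" where
  "residuals f = range (\<lambda>u w. f (u @ w))"

text \<open>Reading a nonempty prefix leaves either zero or a residual of \<open>f\<close>.\<close>

lemma finite_residuals_prepend:
  assumes "finite (residuals f)"
  shows "finite (residuals (prepend s f :: 's list \<Rightarrow> 'k::zero))"
proof -
  have "(\<lambda>w. prepend s f (u @ w)) \<in> insert (prepend s f) (insert (\<lambda>_. 0) (residuals f))" for u
  proof (cases u)
    case (Cons t v)
    then show ?thesis by (cases "t = s") (auto simp: residuals_def)
  qed simp
  then have "residuals (prepend s f) \<subseteq> insert (prepend s f) (insert (\<lambda>_. 0) (residuals f))"
    unfolding residuals_def[of "prepend s f"] by blast
  then show ?thesis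
    using assms by (meson finite_insert finite_subset)
qed

text \<open>A residual of a sum is a sum of residuals, so only finitely many pairs occur; scaling is
  similar.\<close>

lemma subspace_finite_residuals:
  "module.subspace fscale {f :: 's list \<Rightarrow> 'k::field. finite (residuals f)}"
proof -
  interpret vector_space "fscale :: 'k \<Rightarrow> ('s list \<Rightarrow> 'k) \<Rightarrow> _" by (rule vector_space_fscale)
  show ?thesis
  proof (rule subspaceI; unfold mem_Collect_eq)
    show "finite (residuals (0 :: 's list \<Rightarrow> 'k))"
      by (simp add: residuals_def)
  next
    fix f g :: "'s list \<Rightarrow> 'k"
    assume fin: "finite (residuals f)" "finite (residuals g)"
    have "residuals (f + g) \<subseteq> (\<lambda>(f, g). f + g) ` (residuals f \<times> residuals g)"
      by (force simp: residuals_def fun_eq_iff)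
    then show "finite (residuals (f + g))"
      using fin by (meson finite_SigmaI finite_imageI finite_subset)
  next
    fix r :: 'k and f :: "'s list \<Rightarrow> 'k"
    assume fin: "finite (residuals f)"
    have "residuals (fscale r f) \<subseteq> fscale r ` residuals f"
      by (auto simp: residuals_def fscale_def)
    then show "finite (residuals (fscale r f))"
      using fin by (meson finite_imageI finite_subset)
  qed
qed


section \<open>Linear cellular automata\<close>

text \<open>Map a sequence of basis vectors onto \<open>B\<close>, the other basis vectors to 0, and
  extend linearly.\<close>

lemma infinite_dimensional_onto_countable_span:
  fixes smul :: "'k::field \<Rightarrow> 'v::ab_group_add \<Rightarrow> 'v" and scale :: "'k \<Rightarrow> 'w::ab_group_add \<Rightarrow> 'w"
  assumes vs: "vector_space smul" "vector_space scale"
    and inf: "infinite_dimensional smul"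
    and B: "countable B" "B \<noteq> {}"
  shows "\<exists>p. Vector_Spaces.linear smul scale p \<and> range p = module.span scale B"
proof -
  interpret V: vector_space smul by (rule vs)
  interpret W: vector_space scale by (rule vs)
  interpret vector_space_pair smul scale by unfold_locales
  obtain D where D: "V.independent D" "UNIV \<subseteq> V.span D"
    using V.maximal_independent_subset[of UNIV] by blast
  then have "infinite D"
    using inf by (auto simp: infinite_dimensional_def)
  then obtain d :: "nat \<Rightarrow> 'v" where d: "inj d" "range d \<subseteq> D"
    using infinite_countable_subset by blast
  \<comment> \<open>\<open>from_nat_into\<close> may repeat elements, so a finite \<open>B\<close>
    is covered as well.\<close>
  define q where "q v = (if v \<in> range d then from_nat_into B (inv_into UNIV d v) else 0)" for v
  have q: "q (d n) = from_nat_into B n" for n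
    using d by (simp add: q_def)
  have "range (from_nat_into B) = B"
    using B by (rule range_from_nat_into[rotated])
  then have "q ` range d = B"
    unfolding image_image q .
  moreover have "q ` D \<subseteq> insert 0 (q ` range d)"
    by (auto simp: q_def)
  ultimately have "B \<subseteq> q ` D" "q ` D \<subseteq> insert 0 B"
    using d by auto
  then have "W.span B \<subseteq> W.span (q ` D)" "W.span (q ` D) \<subseteq> W.span (insert 0 B)"
    by - (rule W.span_mono, assumption)+
  then have "W.span (q ` D) = W.span B"
    by (simp add: W.span_insert_0)
  then have "range (construct D q) = W.span B"
    by (simp add: range_construct_eq_span[OF D(1)])
  then show ?thesis
    using linear_construct[OF D(1)] by blast
qed

section \<open>Paths in the Cayley graph and their indicators\<close>

context infinite_fg_group
begin

text \<open>
  \<open>stays F g w\<close> says that the path in the Cayley graph from \<open>g\<close> labelled by \<open>w\<close> remains in \<open>F\<close>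
  and ends at the identity.
\<close>

fun stays :: "'a set \<Rightarrow> 'a \<Rightarrow> 'a list \<Rightarrow> bool" where
  "stays F g [] \<longleftrightarrow> g \<in> F \<and> g = \<one>"
| "stays F g (s # w) \<longleftrightarrow> g \<in> F \<and> s \<in> letters \<and> stays F (g \<otimes> s) w"

definition path_ind :: "'a set \<Rightarrow> 'a \<Rightarrow> 'a list \<Rightarrow> 'k::field" where
  "path_ind F g w = of_bool (stays F g w)"

lemma stays_start: "stays F g w \<Longrightarrow> g \<in> F"
  by (cases w) auto

text \<open>In the whole group no path can leave; at \<open>g = \<one>\<close> the word problem
  remains.\<close>

lemma stays_carrier:
  "g \<in> carrier G \<Longrightarrow> stays (carrier G) g w \<longleftrightarrow> w \<in> lists letters \<and> g \<otimes> word_prod w = \<one>"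
proof (induction w arbitrary: g)
  case (Cons s w)
  have "g \<otimes> s \<otimes> word_prod w = g \<otimes> (s \<otimes> word_prod w)" if "s \<in> letters" "w \<in> lists letters"
    using that Cons.prems word_prod_closed[OF that(2)] by (simp add: m_assoc)
  with Cons show ?case
    by (cases "s \<in> letters"; cases "w \<in> lists letters") simp_all
qed simp

text \<open>The points of \<open>F\<close> are the states of a finite automaton: reading
  \<open>u\<close> moves the start along the path, and leaving \<open>F\<close> or reading a
  non-letter gives zero.\<close>

lemma finite_residuals_path_ind:
  assumes "finite F"
  shows "finite (residuals (path_ind F g :: 'a list \<Rightarrow> 'k::field))"
proof -
  let ?R = "insert (\<lambda>_. 0) (path_ind F ` F) :: ('a list \<Rightarrow> 'k) set"
  have outside: "path_ind F h = (\<lambda>_. 0 :: 'k)" if "h \<notin> F" for h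
    using that stays_start by (fastforce simp: path_ind_def fun_eq_iff)
  have "(\<lambda>w. path_ind F h (u @ w)) \<in> ?R" for u h
  proof (induction u arbitrary: h)
    case Nil
    then show ?case
      by (cases "h \<in> F") (auto simp: outside)
  next
    case (Cons s u)
    then show ?case
      by (cases "h \<in> F \<and> s \<in> letters") (auto simp: path_ind_def)
  qed
  then have "residuals (path_ind F g) \<subseteq> ?R"
    by (auto simp: residuals_def)
  then show ?thesis
    using assms by (meson finite_imageI finite_insert finite_subset)
qed

text \<open>In the language of automata: the word problem of an infinite group is not regular.\<close>

lemma infinite_residuals_path_ind_carrier:
  "infinite (residuals (path_ind (carrier G) \<one> :: 'a list \<Rightarrow> 'k::field))"
proof -
  let ?f = "path_ind (carrier G) :: 'a \<Rightarrow> 'a list \<Rightarrow> 'k"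
  \<comment> \<open>A word for \<open>inv g\<close> leads to the identity from \<open>g\<close> and
    from no other element.\<close>
  have "inj_on ?f (carrier G)"
  proof (rule inj_onI)
    fix g h assume gh: "g \<in> carrier G" "h \<in> carrier G" "?f g = ?f h"
    obtain w where w: "w \<in> lists letters" "word_prod w = inv g"
      using ex_word[of "inv g"] gh by auto
    then have "stays (carrier G) g w"
      using gh(1) by (simp add: stays_carrier)
    then have "stays (carrier G) h w"
      using fun_cong[OF gh(3), of w] by (simp add: path_ind_def)
    then have "h \<otimes> inv g = \<one>"
      using gh(2) w by (simp add: stays_carrier)
    then show "g = h"
      using gh by (metis inv_equality inv_inv inv_closed)
  qed
  \<comment> \<open>Reading a word for \<open>g\<close> moves the start from the identity to
    \<open>g\<close>.\<close>
  moreover have "?f g \<in> residuals (?f \<one>)" if g: "g \<in> carrier G" for g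
  proof -
    obtain u where u: "u \<in> lists letters" "word_prod u = g"
      using ex_word[OF g] by blast
    then have "stays (carrier G) \<one> (u @ w) \<longleftrightarrow> stays (carrier G) g w" for w
      using g by (cases "w \<in> lists letters") (simp_all add: stays_carrier word_prod_append)
    then have "?f g = (\<lambda>w. ?f \<one> (u @ w))"
      by (simp add: path_ind_def fun_eq_iff)
    then show ?thesis by (auto simp: residuals_def)
  qed
  then have "?f ` carrier G \<subseteq> residuals (?f \<one>)"
    by blast
  ultimately show ?thesis
    using infinite_carrier finite_imageD finite_subset by metis
qed

text \<open>First-step decomposition: a path is empty, which forces \<open>g = \<one>\<close>, or
  takes a letter \<open>s\<close> and continues from \<open>g \<otimes> s\<close>.\<close>

lemma path_ind_equation:
  assumes "g \<in> F"
  shows "path_ind F g - (\<Sum>s\<in>letters. prepend s (path_ind F (g \<otimes> s)))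
       = (\<lambda>w. of_bool (g = \<one> \<and> w = []) :: 'k::field)"
proof
  fix w
  show "(path_ind F g - (\<Sum>s\<in>letters. prepend s (path_ind F (g \<otimes> s)))) w
      = (of_bool (g = \<one> \<and> w = []) :: 'k)"
    using assms by (cases w) (simp_all add: sum_prepend finite_letters path_ind_def)
qed

text \<open>The prefixes \<open>u\<close> make the span invariant under \<open>prepend\<close>;
  finite \<open>F\<close> keep the generators countable and their residuals finite.\<close>

definition path_space :: "('a list \<Rightarrow> 'k::field) set" where
  "path_space = module.span fscale
     ((\<lambda>(u, F, g). foldr prepend u (path_ind F g)) `
        (lists letters \<times> {F. finite F \<and> F \<subseteq> carrier G} \<times> carrier G))"

lemma path_ind_in_path_space:
  assumes "finite F" "F \<subseteq> carrier G" "g \<in> carrier G"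
  shows "path_ind F g \<in> (path_space :: ('a list \<Rightarrow> 'k::field) set)"
proof -
  interpret vector_space "fscale :: 'k \<Rightarrow> ('a list \<Rightarrow> 'k) \<Rightarrow> _" by (rule vector_space_fscale)
  show ?thesis
    unfolding path_space_def
    using assms by (intro span_base image_eqI[of _ _ "([], F, g)"]) auto
qed

lemma prepend_in_path_space:
  assumes "f \<in> (path_space :: ('a list \<Rightarrow> 'k::field) set)" "s \<in> letters"
  shows "prepend s f \<in> path_space"
proof -
  interpret vector_space "fscale :: 'k \<Rightarrow> ('a list \<Rightarrow> 'k) \<Rightarrow> _" by (rule vector_space_fscale)
  interpret vector_space_pair "fscale :: 'k \<Rightarrow> ('a list \<Rightarrow> 'k) \<Rightarrow> _"
    "fscale :: 'k \<Rightarrow> ('a list \<Rightarrow> 'k) \<Rightarrow> _" by unfold_locales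
  let ?B = "(\<lambda>(u, F, g). foldr prepend u (path_ind F g) :: 'a list \<Rightarrow> 'k) `
        (lists letters \<times> {F. finite F \<and> F \<subseteq> carrier G} \<times> carrier G)"
  have "prepend s ` ?B \<subseteq> ?B"
  proof clarsimp
    fix u F g
    assume "\<forall>x\<in>set u. x \<in> letters" "finite F" "F \<subseteq> carrier G" "g \<in> carrier G"
    then show "prepend s (foldr prepend u (path_ind F g)) \<in> ?B"
      using assms(2) by (intro image_eqI[of _ _ "(s # u, F, g)"]) auto
  qed
  then have "span (prepend s ` ?B) \<subseteq> span ?B"
    by (rule span_mono)
  then have "prepend s ` span ?B \<subseteq> span ?B"
    by (simp only: linear_span_image[OF linear_prepend])
  then show ?thesis
    using assms(1) unfolding path_space_def by blast
qed

lemma finite_residuals_path_space: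
  assumes "f \<in> (path_space :: ('a list \<Rightarrow> 'k::field) set)"
  shows "finite (residuals f)"
proof -
  interpret vector_space "fscale :: 'k \<Rightarrow> ('a list \<Rightarrow> 'k) \<Rightarrow> _" by (rule vector_space_fscale)
  have "finite (residuals (foldr prepend u (path_ind F g) :: 'a list \<Rightarrow> 'k))" if "finite F" for u F g
    by (induction u) (simp_all add: finite_residuals_path_ind[OF that] finite_residuals_prepend)
  then have "path_space \<subseteq> {f :: 'a list \<Rightarrow> 'k. finite (residuals f)}"
    unfolding path_space_def by (intro span_minimal subspace_finite_residuals) auto
  then show ?thesis
    using assms by blast
qed

lemma ex_onto_path_space:
  fixes smul :: "'k::field \<Rightarrow> 'v::ab_group_add \<Rightarrow> 'v"
  assumes "vector_space smul" "infinite_dimensional smul"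
  shows "\<exists>p. Vector_Spaces.linear smul fscale p \<and> range p = path_space"
  unfolding path_space_def
proof (rule infinite_dimensional_onto_countable_span[OF assms(1) vector_space_fscale assms(2)])
  show "countable ((\<lambda>(u, F, g). foldr prepend u (path_ind F g) :: 'a list \<Rightarrow> 'k) `
      (lists letters \<times> {F. finite F \<and> F \<subseteq> carrier G} \<times> carrier G))"
    using finite_letters countable_carrier
    by (intro countable_image countable_SIGMA countable_lists countable_Collect_finite_subset)
      (auto intro: countable_finite)
qed auto

section \<open>Part (b): the linear automaton\<close>

lemma ex_linear_not_closed_image:
  fixes smul :: "'k::field \<Rightarrow> 'v::ab_group_add \<Rightarrow> 'v"
  assumes vs: "vector_space smul" and inf: "infinite_dimensional smul"
  shows "\<exists>\<tau>. linear_cellular_automaton smul G \<tau> \<and>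
             \<not> closedin (prodiscrete G UNIV) (\<tau> ` configs G UNIV)"
proof -
  interpret V: vector_space smul by (rule vs)
  interpret W: vector_space "fscale :: 'k \<Rightarrow> ('a list \<Rightarrow> 'k) \<Rightarrow> _" by (rule vector_space_fscale)
  interpret vector_space_pair smul "fscale :: 'k \<Rightarrow> ('a list \<Rightarrow> 'k) \<Rightarrow> _" by unfold_locales
  interpret WV: vector_space_pair "fscale :: 'k \<Rightarrow> ('a list \<Rightarrow> 'k) \<Rightarrow> _" smul by unfold_locales
  obtain p :: "'v \<Rightarrow> 'a list \<Rightarrow> 'k"
    where p: "Vector_Spaces.linear smul fscale p" and range_p: "range p = path_space"
    using ex_onto_path_space[OF vs inf] by blast
  obtain j where j: "Vector_Spaces.linear fscale smul j" and pj: "\<And>f. f \<in> path_space \<Longrightarrow> p (j f) = f"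
    using linear_exists_right_inverse_on[OF p V.subspace_UNIV] range_p by auto
  note [simp] = linear_add[OF p] linear_scale[OF p] WV.linear_add[OF j] WV.linear_scale[OF j]
  have prep_add: "prepend s (f + g) = prepend s f + prepend s g"
    and prep_scale: "prepend s (fscale r f) = fscale r (prepend s f)"
    for s r and f g :: "'a list \<Rightarrow> 'k"
    using linear_prepend[of s, where 'k='k] by (simp_all add: Vector_Spaces.linear_iff)
  \<comment> \<open>Neighbour values are decoded by \<open>p\<close>, prefixed, and encoded again by
    the section \<open>j\<close>.\<close>
  define \<mu> where "\<mu> z = z \<one> - (\<Sum>s\<in>letters. j (prepend s (p (z s))))" for z :: "'a \<Rightarrow> 'v"
  define M where "M = insert \<one> letters"
  define \<tau> where "\<tau> = local_rule M \<mu>"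
  have M: "finite M" "M \<subseteq> carrier G" and \<mu>: "\<mu> \<in> (M \<rightarrow>\<^sub>E UNIV) \<rightarrow> UNIV"
    using finite_letters by (auto simp: M_def)
  have "linear_local_map smul M \<mu>"
    unfolding linear_local_map_def \<mu>_def M_def
    by (simp add: prep_add prep_scale sum.distrib V.scale_right_diff_distrib V.scale_sum_right)
  then have lin: "linear_cellular_automaton smul G \<tau>"
    unfolding linear_cellular_automaton_def \<tau>_def
    using local_rule_maps_configs[OF M(2) \<mu>] has_local_map_local_rule[OF M \<mu>] by blast
  have \<tau>: "\<tau> x g = x g - (\<Sum>s\<in>letters. j (prepend s (p (x (g \<otimes> s)))))" if "g \<in> carrier G" for x g
    using that by (simp add: \<tau>_def local_rule_def \<mu>_def M_def)
  define \<delta> :: "'a \<Rightarrow> 'a list \<Rightarrow> 'k" where "\<delta> g = (\<lambda>w. of_bool (g = \<one> \<and> w = []))" for g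
  define y where "y = (\<lambda>g\<in>carrier G. j (\<delta> g))"
  \<comment> \<open>The path equation for \<open>F = {g}\<close> writes \<open>\<delta> g\<close>
    through path indicators and their prefixed images.\<close>
  have \<delta>: "\<delta> g \<in> path_space" if "g \<in> carrier G" for g
    unfolding \<delta>_def path_ind_equation[of g "{g}", symmetric, OF singletonI]
    unfolding path_space_def
    using that
    by (intro W.span_diff W.span_sum; fold path_space_def)
      (auto intro!: prepend_in_path_space path_ind_in_path_space)
  have "y \<notin> \<tau> ` configs G UNIV"
  proof
    assume "y \<in> \<tau> ` configs G UNIV"
    then obtain x where x: "y = \<tau> x" by blast
    \<comment> \<open>All arguments of \<open>j\<close> lie in \<open>path_space\<close>, where
      \<open>p\<close> undoes \<open>j\<close>; so the decoded configuration solves the equation on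
      words.\<close>
    have eq: "p (x g) = \<delta> g + (\<Sum>s\<in>letters. prepend s (p (x (g \<otimes> s))))" if g: "g \<in> carrier G" for g
    proof -
      have "x g = j (\<delta> g) + (\<Sum>s\<in>letters. j (prepend s (p (x (g \<otimes> s)))))"
        using \<tau>[OF g, of x] g by (simp add: x[symmetric] y_def algebra_simps)
      moreover have "prepend s (p (x (g \<otimes> s))) \<in> path_space" if "s \<in> letters" for s
        using that range_p by (intro prepend_in_path_space) auto
      ultimately show ?thesis
        using \<delta>[OF g] by (simp add: linear_sum[OF p] pj)
    qed
    \<comment> \<open>The value at \<open>s # w\<close> is determined by that at \<open>w\<close> in
      the cell \<open>g \<otimes> s\<close>, so the solution is unique.\<close>
    have "p (x g) w = path_ind (carrier G) g w" if "g \<in> carrier G" for g w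
      using that
    proof (induction w arbitrary: g)
      case Nil
      then show ?case
        by (simp add: eq sum_prepend finite_letters \<delta>_def path_ind_def)
    next
      case (Cons s w)
      then show ?case
        by (simp add: eq[OF Cons.prems] sum_prepend finite_letters \<delta>_def)
          (simp add: path_ind_def)
    qed
    then have "p (x \<one>) = path_ind (carrier G) \<one>"
      by auto
    moreover have "finite (residuals (p (x \<one>)))"
      using range_p by (intro finite_residuals_path_space) auto
    ultimately show False
      using infinite_residuals_path_ind_carrier[where 'k='k] by simp
  qed
  moreover have "y \<in> \<tau> ` configs G UNIV" if cl: "closedin (prodiscrete G UNIV) (\<tau> ` configs G UNIV)"
  proof (rule closedin_prodiscrete_mem[OF cl])
    show "y \<in> configs G UNIV"
      by (simp add: y_def)
    fix F assume F: "finite F" "F \<subseteq> carrier G"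
    define x where "x = (\<lambda>g\<in>carrier G. j (path_ind F g))"
    have "\<tau> x g = y g" if g: "g \<in> F" for g
    proof -
      have gc: "g \<in> carrier G" using g F by blast
      have "p (x (g \<otimes> s)) = path_ind F (g \<otimes> s)" if "s \<in> letters" for s
        using that gc F by (simp add: x_def pj path_ind_in_path_space)
      then have "\<tau> x g = j (path_ind F g) - (\<Sum>s\<in>letters. j (prepend s (path_ind F (g \<otimes> s))))"
        using gc by (simp add: \<tau> x_def)
      also have "\<dots> = j (\<delta> g)"
        by (simp add: \<delta>_def path_ind_equation[OF g, symmetric] WV.linear_diff[OF j] WV.linear_sum[OF j])
      finally show ?thesis
        using gc by (simp add: y_def)
    qed
    moreover have "x \<in> configs G UNIV"
      by (simp add: x_def)
    ultimately show "\<exists>z\<in>\<tau> ` configs G UNIV. \<forall>g\<in>F. z g = y g"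
      by blast
  qed
  ultimately show ?thesis
    using lin by blast
qed

end


section \<open>The Grigorchuk group is infinite\<close>

abbreviation grig_generators :: "(word \<Rightarrow> word) set" where
  "grig_generators \<equiv> {grig_a, grig_b, grig_c, grig_d}"

lemma carrier_Grigorchuk: "carrier Grigorchuk = generate tree_aut grig_generators"
  using grig_generators_in_tree_aut
  by (simp add: Grigorchuk_def carrier_subgroup_generated Int_absorb1)

lemma mult_Grigorchuk [simp]: "f \<otimes>\<^bsub>Grigorchuk\<^esub> g = f \<circ> g"
  by (simp add: Grigorchuk_def tree_aut_def)

lemma one_Grigorchuk [simp]: "\<one>\<^bsub>Grigorchuk\<^esub> = id"
  by (simp add: Grigorchuk_def tree_aut_def)

lemma grig_generators_in_Grigorchuk: "grig_generators \<subseteq> carrier Grigorchuk"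
  unfolding carrier_Grigorchuk by (auto intro: generate.incl)

text \<open>The group is defined by generation inside \<open>tree_aut\<close>; the locale asks for
  generation inside the group itself.\<close>

lemma generate_Grigorchuk: "generate Grigorchuk grig_generators = carrier Grigorchuk"
proof -
  have "carrier (subgroup_generated Grigorchuk grig_generators) = carrier Grigorchuk"
    by (simp add: Grigorchuk_def group.subgroup_generated2[OF group_tree_aut])
  then show ?thesis
    using grig_generators_in_Grigorchuk by (simp add: carrier_subgroup_generated Int_absorb1)
qed

section \<open>Self-similarity on the right subtree\<close>

lemma Grigorchuk_comp:
  "f \<in> carrier Grigorchuk \<Longrightarrow> g \<in> carrier Grigorchuk \<Longrightarrow> f \<circ> g \<in> carrier Grigorchuk"
  using monoid.m_closed[OF group.is_monoid[OF group_Grigorchuk]] by (metis mult_Grigorchuk)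

lemma inv_tree_aut_involution:
  assumes "f \<in> carrier tree_aut" "\<And>w. f (f w) = w"
  shows "inv\<^bsub>tree_aut\<^esub> f = f"
  using assms by (intro group.inv_equality[OF group_tree_aut]) (auto simp: tree_aut_def)

text \<open>On the right subtree \<open>grig_b\<close>, \<open>grig_c\<close>, \<open>grig_d\<close>
  act as \<open>grig_c\<close>, \<open>grig_d\<close>, \<open>grig_b\<close>. Conjugation by
  \<open>grig_a\<close> moves the action of \<open>grig_b\<close> on the left subtree, which is
  \<open>grig_a\<close>, to the right.\<close>

lemma grig_generator_lift:
  assumes "f \<in> grig_generators"
  shows "\<exists>h\<in>carrier Grigorchuk. \<forall>w. h (True # w) = True # f w"
proof -
  have gens: "grig_a \<in> carrier Grigorchuk" "grig_b \<in> carrier Grigorchuk"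
    "grig_c \<in> carrier Grigorchuk" "grig_d \<in> carrier Grigorchuk"
    using grig_generators_in_Grigorchuk by auto
  have "grig_a \<circ> (grig_b \<circ> grig_a) \<in> carrier Grigorchuk"
    by (intro Grigorchuk_comp gens)
  moreover have "(grig_a \<circ> (grig_b \<circ> grig_a)) (True # w) = True # grig_a w" for w
    by simp
  moreover have "grig_d (True # w) = True # grig_b w" "grig_b (True # w) = True # grig_c w"
    "grig_c (True # w) = True # grig_d w" for w
    by simp_all
  ultimately show ?thesis
    using assms gens by blast
qed

text \<open>Lifts compose, and the generators are their own inverses.\<close>

lemma Grigorchuk_lift:
  assumes "f \<in> carrier Grigorchuk"
  shows "\<exists>h\<in>carrier Grigorchuk. \<forall>w. h (True # w) = True # f w"
proof -
  have "f \<in> generate tree_aut grig_generators"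
    using assms by (simp add: carrier_Grigorchuk)
  then show ?thesis
  proof induction
    case one
    have "id \<in> carrier Grigorchuk"
      using monoid.one_closed[OF group.is_monoid[OF group_Grigorchuk]] by simp
    then show ?case by (intro bexI[of _ id]) (auto simp: tree_aut_def)
  next
    case (incl f)
    then show ?case by (rule grig_generator_lift)
  next
    case (inv f)
    then have "f (f w) = w" for w
      by (auto simp: grig_a_involution grig_bcd_involution)
    then have "inv\<^bsub>tree_aut\<^esub> f = f"
      using inv grig_generators_in_tree_aut by (intro inv_tree_aut_involution) auto
    then show ?case
      using grig_generator_lift[OF inv] by simp
  next
    case (eng f g)
    then obtain h k where "h \<in> carrier Grigorchuk" "k \<in> carrier Grigorchuk"
      "\<forall>w. h (True # w) = True # f w" "\<forall>w. k (True # w) = True # g w"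
      by blast
    then show ?case
      by (intro bexI[of _ "h \<circ> k"]) (auto simp: tree_aut_def Grigorchuk_comp)
  qed
qed

text \<open>Lifting is injective, hence onto if the group is finite; but lifts preserve the right
  subtree and \<open>grig_a\<close> does not.\<close>

lemma infinite_Grigorchuk: "infinite (carrier Grigorchuk)"
proof
  assume fin: "finite (carrier Grigorchuk)"
  obtain \<phi> where \<phi>: "\<And>f. f \<in> carrier Grigorchuk \<Longrightarrow> \<phi> f \<in> carrier Grigorchuk"
    "\<And>f w. f \<in> carrier Grigorchuk \<Longrightarrow> \<phi> f (True # w) = True # f w"
    using Grigorchuk_lift by metis
  have "inj_on \<phi> (carrier Grigorchuk)"
    using \<phi>(2) by (intro inj_onI ext) (metis list.inject)
  then have "\<phi> ` carrier Grigorchuk = carrier Grigorchuk"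
    using fin \<phi>(1) by (intro endo_inj_surj) auto
  moreover have "grig_a \<in> carrier Grigorchuk"
    using grig_generators_in_Grigorchuk by simp
  ultimately obtain f where "f \<in> carrier Grigorchuk" "\<phi> f = grig_a"
    by (metis (no_types) imageE)
  then show False
    using \<phi>(2)[of f "[]"] by simp
qed

theorem corollary6p2:
  shows "(\<forall>A :: 'a set. infinite A \<longrightarrow>
            (\<exists>\<tau>. cellular_automaton Grigorchuk A \<tau> \<and>
                 \<not> closedin (prodiscrete Grigorchuk A) (\<tau> ` configs Grigorchuk A)))
       \<and> (\<forall>smul :: 'k::field \<Rightarrow> 'v::ab_group_add \<Rightarrow> 'v.
            vector_space smul \<and> infinite_dimensional smul \<longrightarrow>
            (\<exists>\<tau>. linear_cellular_automaton smul Grigorchuk \<tau> \<and>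
                 \<not> closedin (prodiscrete Grigorchuk (UNIV :: 'v set))
                     (\<tau> ` configs Grigorchuk (UNIV :: 'v set))))"
proof -
  interpret group Grigorchuk by (rule group_Grigorchuk)
  interpret infinite_fg_group Grigorchuk grig_generators
    by unfold_locales
      (rule finite.intros grig_generators_in_Grigorchuk generate_Grigorchuk infinite_Grigorchuk)+
  show ?thesis
    by (intro conjI allI impI ex_not_closed_image ex_linear_not_closed_image) simp_all
qed

end
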